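(* The warping polynomial has the following properties, for every knot diagram $D$: (i) $W_{\bigcirc}(t)=1$, where $\bigcirc$ is the knot diagram with $c(\bigcirc)=0$; (ii) $\mathrm{l}\text{-}\mathrm{deg}\,W_D(t)=d(D)$; (iii) $D$ is monotone if and only if $W_D(0)\ne 0$; (iv) if $c(D)\ge 1$, then $W_D(1)=2c(D)$.
   Context: All knot diagrams are oriented and lie on $S^2$. $c(D)$ is the number of crossings of the diagram $D$. A base point $b$ of a knot diagram $D$ is a point of $D$ that is not a crossing point. A crossing point of $D$ is a warping crossing point of $D_b=(D,b)$ if, going along $D$ following its orientation starting from $b$, one meets that crossing first as an under-crossing. The warping degree $d(D_b)$ is the number of warping crossing points of $D_b$, and $d(D)=\min_b d(D_b)$ over all base points $b$ of $D$. $D$ is monotone if $d(D)=0$. An edge of $D$ is a path on $D$ between (consecutive) crossing points with no crossings in its interior; for the diagram with no crossings, the whole circle counts as one edge. The warping degree $i(e)$ of an edge $e$ is $d(D_b)$ for any base point $b$ on $e$. The warping polynomial of $D$ is $W_D(t)=\sum_e t^{i(e)}$, the sum over all edges $e$ of $D$. $\mathrm{l}\text{-}\mathrm{deg}$ denotes the lowest degree of a term with nonzero coefficient. *)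

theory Defs
  imports "HOL-Analysis.Analysis" "HOL-Computational_Algebra.Polynomial"
begin

text \<open>
  An oriented knot diagram is given by a closed curve on the unit sphere, parametrized with
  period 1 in the direction of the orientation, together with over/under data. The value
  \<open>over D t\<close> only matters when the curve passes through a crossing at time \<open>t\<close>; it says
  that this passage is the upper one.
\<close>

record diagram =
  curve :: "real \<Rightarrow> real ^ 3"
  over :: "real \<Rightarrow> bool"

definition smooth :: "(real \<Rightarrow> 'a::real_normed_vector) \<Rightarrow> bool" where
  "smooth f \<longleftrightarrow> (\<exists>g :: nat \<Rightarrow> real \<Rightarrow> 'a.
     g 0 = f \<and> (\<forall>n t. (g n has_vector_derivative g (Suc n) t) (at t)))"

definition velocity :: "diagram \<Rightarrow> real \<Rightarrow> real ^ 3" where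
  "velocity D t = vector_derivative (curve D) (at t)"

definition crossings :: "diagram \<Rightarrow> (real ^ 3) set" where
  "crossings D = {x. \<exists>s t. curve D s = x \<and> curve D t = x \<and> s - t \<notin> \<int>}"

text \<open>
  Parameters are identified modulo \<open>\<int>\<close>. The curve is a smooth immersion of the circle whose
  only multiple points are finitely many transverse double points. Transversality is stated
  with \<open>collinear\<close> because \<open>independent {v, w}\<close> would also hold for \<open>v = w \<noteq> 0\<close>.
\<close>

definition knot_diagram :: "diagram \<Rightarrow> bool" where
  "knot_diagram D \<longleftrightarrow>
     range (curve D) \<subseteq> sphere 0 1 \<and>
     smooth (curve D) \<and>
     (\<forall>t. curve D (t + 1) = curve D t) \<and>
     (\<forall>t. velocity D t \<noteq> 0) \<and>
     finite (crossings D) \<and>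
     (\<forall>r s t. curve D r = curve D s \<and> curve D s = curve D t \<longrightarrow>
        r - s \<in> \<int> \<or> s - t \<in> \<int> \<or> r - t \<in> \<int>) \<and>
     (\<forall>s t. curve D s = curve D t \<and> s - t \<notin> \<int> \<longrightarrow>
        \<not> collinear {0, velocity D s, velocity D t}) \<and>
     (\<forall>t. over D (t + 1) = over D t) \<and>
     (\<forall>s t. curve D s = curve D t \<and> s - t \<notin> \<int> \<longrightarrow> over D s \<noteq> over D t)"

definition crossing_number :: "diagram \<Rightarrow> nat" where
  "crossing_number D = card (crossings D)"

definition base_points :: "diagram \<Rightarrow> (real ^ 3) set" where
  "base_points D = range (curve D) - crossings D"

text \<open>
  Here \<open>s\<close> is a time at which the curve is at \<open>b\<close> (unique modulo \<open>\<int>\<close>), and \<open>t\<close> is the time of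
  the first subsequent passage through \<open>x\<close>.
\<close>

definition warping_crossings :: "diagram \<Rightarrow> real ^ 3 \<Rightarrow> (real ^ 3) set" where
  "warping_crossings D b = {x \<in> crossings D. \<exists>s t. curve D s = b \<and> s < t \<and> curve D t = x \<and>
     (\<forall>u. s < u \<and> u < t \<longrightarrow> curve D u \<noteq> x) \<and> \<not> over D t}"

definition warping_degree_at :: "diagram \<Rightarrow> real ^ 3 \<Rightarrow> nat" where
  "warping_degree_at D b = card (warping_crossings D b)"

definition warping_degree :: "diagram \<Rightarrow> nat" where
  "warping_degree D = Min (warping_degree_at D ` base_points D)"

definition monotone_diagram :: "diagram \<Rightarrow> bool" where
  "monotone_diagram D \<longleftrightarrow> warping_degree D = 0"

text \<open>
  Edges are closed arcs, as point sets on the sphere; the base points on an edge are the points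
  of its interior.
\<close>

definition edges :: "diagram \<Rightarrow> (real ^ 3) set set" where
  "edges D = (if crossings D = {} then {range (curve D)}
     else {curve D ` {s..t} | s t. s < t \<and> curve D s \<in> crossings D \<and> curve D t \<in> crossings D \<and>
       (\<forall>u. s < u \<and> u < t \<longrightarrow> curve D u \<notin> crossings D)})"

definition edge_degree :: "diagram \<Rightarrow> (real ^ 3) set \<Rightarrow> nat" where
  "edge_degree D e = (THE i. \<forall>b \<in> e \<inter> base_points D. warping_degree_at D b = i)"

definition warping_polynomial :: "diagram \<Rightarrow> int poly" where
  "warping_polynomial D = (\<Sum>e\<in>edges D. monom 1 (edge_degree D e))"

definition ldeg :: "'a::zero poly \<Rightarrow> nat" where
  "ldeg p = (LEAST n. coeff p n \<noteq> 0)"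

end

theory Submission
  imports Defs
begin

text \<open>
  Call a parameter a crossing time if the curve is at a crossing there. Crossing times form a
  \<open>\<int>\<close>-periodic set with finitely many classes modulo \<open>\<int>\<close>, in fact two for each crossing, because
  a crossing is a double point and not a triple one. The whole statement is about
  the gaps between consecutive crossing times.

  If there are no crossings, the only edge is the whole circle and all warping degrees are \<open>0\<close>.
  Otherwise each edge is the image of a gap. The curve is injective modulo \<open>\<int>\<close> away from the crossing
  times, so an edge, although it is only a point set on the sphere, determines its gap up to an
  integer translation (\<open>gap_unique_of_edge\<close>). Hence there are as many edges as classes of
  crossing times, namely twice the number of crossings (\<open>card_edges\<close>).

  Moving the base point inside a gap passes no crossing, so it does not change which passage
  through a given crossing comes first. The warping degree is therefore constant on the base points
  of an edge (\<open>edge_degree_eq\<close>). Since every base point lies on an edge and every edge carries a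
  base point, the exponents in the warping polynomial are precisely the warping degrees
  of the based diagrams (\<open>edge_degree_image\<close>).

  What remains is algebra: in a sum of monomials with coefficient \<open>1\<close> in characteristic zero
  nothing cancels, so the lowest degree is the least exponent, the value at \<open>0\<close> counts the
  exponents that vanish, and the value at \<open>1\<close> counts the summands.
\<close>

section \<open>Sums of monomials\<close>

text \<open>
  Each coefficient counts the indices with the given exponent, so it vanishes only where there
  is no such index. This is the absence of cancellation.
\<close>

lemma coeff_sum_monom_neq_0_iff:
  fixes f :: "'a \<Rightarrow> nat"
  assumes "finite A"
  shows "coeff (\<Sum>a\<in>A. monom (1 :: int) (f a)) n \<noteq> 0 \<longleftrightarrow> n \<in> f ` A"
proof -
  have "coeff (\<Sum>a\<in>A. monom (1 :: int) (f a)) n = (\<Sum>a\<in>A. if f a = n then 1 else 0)"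
    by (simp add: coeff_sum)
  also have "\<dots> = int (card {a \<in> A. f a = n})"
    using assms by (simp add: sum.If_cases Int_def)
  finally show ?thesis
    using assms by auto
qed

lemma ldeg_sum_monom:
  fixes f :: "'a \<Rightarrow> nat"
  assumes "finite A" "A \<noteq> {}"
  shows "ldeg (\<Sum>a\<in>A. monom (1 :: int) (f a)) = Min (f ` A)"
  unfolding ldeg_def coeff_sum_monom_neq_0_iff[OF assms(1)]
  using assms by (intro Least_equality) auto

section \<open>Crossing times and gaps\<close>

definition crossing_times :: "diagram \<Rightarrow> real set" where
  "crossing_times D = {t. curve D t \<in> crossings D}"

definition gap :: "diagram \<Rightarrow> real \<Rightarrow> real \<Rightarrow> bool" where
  "gap D s t \<longleftrightarrow> s < t \<and> s \<in> crossing_times D \<and> t \<in> crossing_times D \<and>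
     (\<forall>u. s < u \<and> u < t \<longrightarrow> u \<notin> crossing_times D)"

lemma edges_eq_gap_images:
  assumes "crossings D \<noteq> {}"
  shows "edges D = {curve D ` {s..t} | s t. gap D s t}"
  using assms by (auto simp: edges_def gap_def crossing_times_def)

lemma gap_eq_if_overlap:
  assumes "gap D s t" "gap D s' t'" "s < u" "u < t" "s' < u" "u < t'"
  shows "s = s'" "t = t'"
  using assms unfolding gap_def by (smt (verit))+

lemma periodic_add_int:
  fixes f :: "real \<Rightarrow> 'a"
  assumes "\<And>t. f (t + 1) = f t"
  shows "f (t + of_int k) = f t"
proof (induction k rule: int_induct[where k = 0])
  case base
  show ?case by simp
next
  case (step1 i)
  then show ?case using assms[of "t + of_int i"] by (simp add: add.assoc)
next
  case (step2 i)
  then show ?case using assms[of "t + of_int (i - 1)"] by (simp add: algebra_simps)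
qed

locale knot =
  fixes D :: diagram
  assumes knot_diagram: "knot_diagram D"
begin

lemma curve_add_int: "curve D (t + of_int k) = curve D t"
  by (rule periodic_add_int) (use knot_diagram in \<open>simp add: knot_diagram_def\<close>)

lemma over_add_int: "over D (t + of_int k) = over D t"
  by (rule periodic_add_int) (use knot_diagram in \<open>simp add: knot_diagram_def\<close>)

lemma curve_frac: "curve D (frac t) = curve D t"
  using curve_add_int[of t "- \<lfloor>t\<rfloor>"] by (simp add: frac_def)

lemma crossing_times_add_int:
  "t + of_int k \<in> crossing_times D \<longleftrightarrow> t \<in> crossing_times D"
  by (simp add: crossing_times_def curve_add_int)

lemma gap_add_int:
  assumes "gap D s t"
  shows "gap D (s + of_int k) (t + of_int k)"
proof -
  have "u \<notin> crossing_times D" if "s + of_int k < u" "u < t + of_int k" for u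
    using assms that crossing_times_add_int[of "u - of_int k" k]
    unfolding gap_def by (auto simp: algebra_simps)
  then show ?thesis
    using assms by (auto simp: gap_def crossing_times_add_int)
qed

lemma finite_crossings: "finite (crossings D)"
  using knot_diagram by (simp add: knot_diagram_def)

lemma curve_eq_noncrossing:
  assumes "curve D s = curve D t" "t \<notin> crossing_times D"
  obtains k where "s = t + of_int k"
proof -
  have "s - t \<in> \<int>"
    using assms by (auto simp: crossing_times_def crossings_def)
  then obtain k where "s - t = of_int k"
    by (auto elim: Ints_cases)
  then have "s = t + of_int k" by simp
  then show ?thesis by (rule that)
qed

text \<open>
  At least two times modulo \<open>\<int>\<close> come from the definition of a crossing, at most two from the
  exclusion of triple points.
\<close>

lemma card_crossing_fibre:
  assumes "x \<in> crossings D"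
  shows "card {t \<in> {0..<1}. curve D t = x} = 2"
proof -
  obtain s t where st: "curve D s = x" "curve D t = x" "s - t \<notin> \<int>"
    using assms by (auto simp: crossings_def)
  have frac_eq: "frac r = frac r'" if "r - r' \<in> \<int>" for r r' :: real
  proof -
    obtain k where "r - r' = of_int k"
      using \<open>r - r' \<in> \<int>\<close> by (auto elim: Ints_cases)
    then have "r = r' + of_int k" by simp
    then show ?thesis by (simp add: frac_def)
  qed
  have "r = frac s \<or> r = frac t" if "r \<in> {0..<1}" "curve D r = x" for r
  proof -
    have "r - s \<in> \<int> \<or> s - t \<in> \<int> \<or> r - t \<in> \<int>"
      using knot_diagram st that unfolding knot_diagram_def by metis
    moreover have "frac r = r"
      using that by (auto simp: Archimedean_Field.frac_eq)
    ultimately show ?thesis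
      using st(3) frac_eq by metis
  qed
  then have "{t \<in> {0..<1}. curve D t = x} = {frac s, frac t}"
    using st by (auto simp: curve_frac frac_lt_1)
  moreover have "frac s \<noteq> frac t"
  proof
    assume "frac s = frac t"
    then have "s - t = of_int (\<lfloor>s\<rfloor> - \<lfloor>t\<rfloor>)"
      by (simp add: frac_def)
    then show False
      using st(3) Ints_of_int by metis
  qed
  ultimately show ?thesis by simp
qed

lemma finite_crossing_fibre:
  assumes "x \<in> crossings D"
  shows "finite {t \<in> {0..<1}. curve D t = x}"
  using card_crossing_fibre[OF assms] by (intro card_ge_0_finite) linarith

lemma crossing_times_period:
  "crossing_times D \<inter> {0..<1} = (\<Union>x\<in>crossings D. {t \<in> {0..<1}. curve D t = x})"
  by (auto simp: crossing_times_def)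

lemma finite_crossing_times_period: "finite (crossing_times D \<inter> {0..<1})"
  unfolding crossing_times_period
  using finite_crossings finite_crossing_fibre by (rule finite_UN_I)

lemma card_crossing_times_period:
  "card (crossing_times D \<inter> {0..<1}) = 2 * crossing_number D"
proof -
  have "card (crossing_times D \<inter> {0..<1}) =
      (\<Sum>x\<in>crossings D. card {t \<in> {0..<1}. curve D t = x})"
    unfolding crossing_times_period
    using finite_crossings finite_crossing_fibre by (intro card_UN_disjoint) blast+
  also have "\<dots> = (\<Sum>x\<in>crossings D. 2)"
    using card_crossing_fibre by (rule sum.cong[OF refl])
  finally show ?thesis
    by (simp add: crossing_number_def)
qed

lemma finite_crossing_times_interval: "finite (crossing_times D \<inter> {a..b})"
proof (rule finite_subset)
  show "crossing_times D \<inter> {a..b} \<subseteq>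
      (\<Union>k\<in>{\<lfloor>a\<rfloor>..\<lfloor>b\<rfloor>}. (\<lambda>u. u + of_int k) ` (crossing_times D \<inter> {0..<1}))"
  proof
    fix t
    assume t: "t \<in> crossing_times D \<inter> {a..b}"
    then have "frac t \<in> crossing_times D \<inter> {0..<1}"
      by (auto simp: crossing_times_def curve_frac frac_lt_1)
    moreover have "t = frac t + of_int \<lfloor>t\<rfloor>"
      by (simp add: frac_def)
    moreover have "\<lfloor>t\<rfloor> \<in> {\<lfloor>a\<rfloor>..\<lfloor>b\<rfloor>}"
      using t by (auto intro: floor_mono)
    ultimately show
      "t \<in> (\<Union>k\<in>{\<lfloor>a\<rfloor>..\<lfloor>b\<rfloor>}. (\<lambda>u. u + of_int k) ` (crossing_times D \<inter> {0..<1}))"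
      by blast
  qed
  show "finite (\<Union>k\<in>{\<lfloor>a\<rfloor>..\<lfloor>b\<rfloor>}. (\<lambda>u. u + of_int k) ` (crossing_times D \<inter> {0..<1}))"
    using finite_crossing_times_period by blast
qed

text \<open>
  By periodicity, one crossing time yields crossing times on both sides of every parameter; by
  local finiteness, there is a nearest one on each side.
\<close>

lemma next_crossing_time:
  assumes "crossings D \<noteq> {}"
  obtains t where "m < t" "t \<in> crossing_times D"
    "\<And>u. m < u \<Longrightarrow> u < t \<Longrightarrow> u \<notin> crossing_times D"
proof -
  obtain r where r: "r \<in> crossing_times D"
    using assms by (auto simp: crossings_def crossing_times_def)
  define r' where "r' = r + of_int (\<lfloor>m - r\<rfloor> + 1)"
  let ?A = "crossing_times D \<inter> {m..r'} - {m}"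
  have "m < r'"
    unfolding r'_def by linarith
  moreover have "r' \<in> crossing_times D"
    unfolding r'_def using r crossing_times_add_int by blast
  ultimately have ne: "r' \<in> ?A"
    by auto
  have fin: "finite ?A"
    using finite_crossing_times_interval by blast
  have in_A: "Min ?A \<in> ?A"
    using fin ne by (intro Min_in) auto
  have nearest: "u \<notin> crossing_times D" if "m < u" "u < Min ?A" for u
  proof
    assume "u \<in> crossing_times D"
    then have "u \<in> ?A"
      using that Min_le[OF fin ne] by simp
    then have "Min ?A \<le> u"
      by (rule Min_le[OF fin])
    then show False
      using that by simp
  qed
  have "m < Min ?A" "Min ?A \<in> crossing_times D"
    using in_A by simp_all
  then show ?thesis
    using nearest by (rule that)
qed

lemma previous_crossing_time:
  assumes "crossings D \<noteq> {}"
  obtains t where "t < m" "t \<in> crossing_times D"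
    "\<And>u. t < u \<Longrightarrow> u < m \<Longrightarrow> u \<notin> crossing_times D"
proof -
  obtain r where r: "r \<in> crossing_times D"
    using assms by (auto simp: crossings_def crossing_times_def)
  define r' where "r' = r + of_int (\<lceil>m - r\<rceil> - 1)"
  let ?A = "crossing_times D \<inter> {r'..m} - {m}"
  have "r' < m"
    unfolding r'_def by linarith
  moreover have "r' \<in> crossing_times D"
    unfolding r'_def using r crossing_times_add_int by blast
  ultimately have ne: "r' \<in> ?A"
    by auto
  have fin: "finite ?A"
    using finite_crossing_times_interval by blast
  have in_A: "Max ?A \<in> ?A"
    using fin ne by (intro Max_in) auto
  have nearest: "u \<notin> crossing_times D" if "Max ?A < u" "u < m" for u
  proof
    assume "u \<in> crossing_times D"
    then have "u \<in> ?A"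
      using that Max_ge[OF fin ne] by simp
    then have "u \<le> Max ?A"
      by (rule Max_ge[OF fin])
    then show False
      using that by simp
  qed
  have "Max ?A < m" "Max ?A \<in> crossing_times D"
    using in_A by simp_all
  then show ?thesis
    using nearest by (rule that)
qed

lemma gap_from_crossing_time:
  assumes "s \<in> crossing_times D"
  obtains t where "gap D s t"
proof -
  have "crossings D \<noteq> {}"
    using assms by (auto simp: crossing_times_def)
  from next_crossing_time[OF this, of s] show ?thesis
    using that assms unfolding gap_def by metis
qed

lemma gap_around_noncrossing:
  assumes "crossings D \<noteq> {}" "m \<notin> crossing_times D"
  obtains s t where "gap D s t" "s < m" "m < t"
proof -
  obtain t where t: "m < t" "t \<in> crossing_times D"
    "\<And>u. m < u \<Longrightarrow> u < t \<Longrightarrow> u \<notin> crossing_times D"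
    using next_crossing_time[OF assms(1)] by blast
  obtain s where s: "s < m" "s \<in> crossing_times D"
    "\<And>u. s < u \<Longrightarrow> u < m \<Longrightarrow> u \<notin> crossing_times D"
    using previous_crossing_time[OF assms(1)] by blast
  have "gap D s t"
    unfolding gap_def using s t assms(2) by (metis less_trans linorder_less_linear)
  then show ?thesis
    using that s t by blast
qed

section \<open>Counting the edges\<close>

text \<open>
  An interior point of the common edge is visited once per period. A visit inside one gap and a
  visit inside the other thus differ by an integer, and translating by it makes the gaps overlap.
\<close>

lemma gap_unique_of_edge:
  assumes "gap D s t" "gap D s' t'" "curve D ` {s..t} = curve D ` {s'..t'}"
  obtains k where "s' = s + of_int k" "t' = t + of_int k"
proof -
  define m where "m = (s + t) / 2"
  have m: "s < m" "m < t" "m \<notin> crossing_times D"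
    using assms(1) by (auto simp: gap_def m_def)
  then have "curve D m \<in> curve D ` {s..t}"
    by simp
  then have "curve D m \<in> curve D ` {s'..t'}"
    by (simp only: assms(3))
  then obtain u where u: "s' \<le> u" "u \<le> t'" "curve D u = curve D m"
    by auto
  have "u \<notin> crossing_times D"
    using u m by (simp add: crossing_times_def)
  then have u': "s' < u" "u < t'"
    using u assms(2) by (auto simp: gap_def order.order_iff_strict)
  obtain k where k: "u = m + of_int k"
    using curve_eq_noncrossing[OF u(3) m(3)] .
  have "s' = s + of_int k" "t' = t + of_int k"
    using gap_eq_if_overlap[OF assms(2) gap_add_int[OF assms(1), of k] u'] k m by auto
  then show ?thesis by (rule that)
qed

text \<open>
  An edge is labelled by the crossing time in \<open>{0..<1}\<close> at which it starts. Without crossings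
  there is no such label, while the whole circle counts as one edge.
\<close>

lemma bij_betw_crossing_times_edges:
  assumes "crossings D \<noteq> {}"
  obtains f where "bij_betw f (crossing_times D \<inter> {0..<1}) (edges D)"
proof -
  have "\<forall>s\<in>crossing_times D. \<exists>t. gap D s t"
    using gap_from_crossing_time by metis
  then obtain g where g: "gap D s (g s)" if "s \<in> crossing_times D" for s
    by metis
  let ?f = "\<lambda>s. curve D ` {s..g s}"
  have "inj_on ?f (crossing_times D \<inter> {0..<1})"
  proof (rule inj_onI)
    fix s s'
    assume s: "s \<in> crossing_times D \<inter> {0..<1}" "s' \<in> crossing_times D \<inter> {0..<1}"
      and "?f s = ?f s'"
    then obtain k where "s' = s + of_int k"
      using gap_unique_of_edge g by (metis IntD1)
    then have "s' = s + of_int k" "\<bar>of_int k :: real\<bar> < 1"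
      using s by auto
    then show "s = s'" by simp
  qed
  moreover have "?f ` (crossing_times D \<inter> {0..<1}) = edges D"
  proof
    show "?f ` (crossing_times D \<inter> {0..<1}) \<subseteq> edges D"
      unfolding edges_eq_gap_images[OF assms] using g by blast
  next
    show "edges D \<subseteq> ?f ` (crossing_times D \<inter> {0..<1})"
    proof
      fix e
      assume "e \<in> edges D"
      then obtain s t where st: "e = curve D ` {s..t}" "gap D s t"
        unfolding edges_eq_gap_images[OF assms] by blast
      define k where "k = - \<lfloor>s\<rfloor>"
      have frac: "frac s = s + of_int k"
        by (simp add: frac_def k_def)
      have gap: "gap D (frac s) (t + of_int k)"
        using gap_add_int[OF st(2), of k] by (simp only: frac)
      then have mem: "frac s \<in> crossing_times D \<inter> {0..<1}"
        by (auto simp: gap_def frac_lt_1)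
      have next_unique: "g (frac s) = t + of_int k"
        using gap g[of "frac s"] mem unfolding gap_def by (meson IntD1 linorder_less_linear)
      have "{frac s..t + of_int k} = (\<lambda>u. u + of_int k) ` {s..t}"
        by (simp add: frac)
      then have "?f (frac s) = curve D ` (\<lambda>u. u + of_int k) ` {s..t}"
        by (simp only: next_unique)
      also have "\<dots> = curve D ` {s..t}"
        by (simp only: image_image curve_add_int)
      finally have "?f (frac s) = curve D ` {s..t}" .
      then show "e \<in> ?f ` (crossing_times D \<inter> {0..<1})"
        using mem st(1) by blast
    qed
  qed
  ultimately show ?thesis
    using that unfolding bij_betw_def by blast
qed

lemma card_edges:
  assumes "crossings D \<noteq> {}"
  shows "card (edges D) = 2 * crossing_number D"
  using bij_betw_crossing_times_edges[OF assms] bij_betw_same_card card_crossing_times_period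
  by metis

lemma finite_edges: "finite (edges D)"
proof (cases "crossings D = {}")
  case True
  then show ?thesis by (simp add: edges_def)
next
  case False
  then show ?thesis
    using bij_betw_crossing_times_edges bij_betw_finite finite_crossing_times_period by metis
qed

section \<open>The warping degree along an edge\<close>

lemma curve_in_base_points_iff: "curve D u \<in> base_points D \<longleftrightarrow> u \<notin> crossing_times D"
  by (auto simp: base_points_def crossing_times_def)

lemma edge_has_base_point:
  assumes "e \<in> edges D"
  shows "e \<inter> base_points D \<noteq> {}"
proof (cases "crossings D = {}")
  case True
  then show ?thesis
    using assms by (auto simp: edges_def base_points_def)
next
  case False
  then obtain s t where st: "e = curve D ` {s..t}" "gap D s t"
    using assms edges_eq_gap_images by blast
  then have "(s + t) / 2 \<in> {s..t}" "(s + t) / 2 \<notin> crossing_times D"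
    by (auto simp: gap_def)
  then show ?thesis
    using st(1) curve_in_base_points_iff by blast
qed

lemma base_point_on_edge:
  assumes "b \<in> base_points D"
  obtains e where "e \<in> edges D" "b \<in> e"
proof (cases "crossings D = {}")
  case True
  then show ?thesis
    using assms that by (auto simp: edges_def base_points_def)
next
  case False
  obtain m where m: "b = curve D m" "m \<notin> crossing_times D"
    using assms by (auto simp: base_points_def crossing_times_def)
  obtain s t where "gap D s t" "s < m" "m < t"
    using gap_around_noncrossing[OF False m(2)] .
  then have "curve D ` {s..t} \<in> edges D" "b \<in> curve D ` {s..t}"
    using m(1) edges_eq_gap_images[OF False] by auto
  then show ?thesis by (rule that)
qed

text \<open>
  Both base points come before the end of the gap and every later crossing time comes no earlier
  than it, so the first passage through a crossing after the one is also the first after the other.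
\<close>

lemma warping_crossings_gap_subset:
  assumes gap: "gap D p q" and m: "p < m" "m < q" and m': "p < m'" "m' < q"
  shows "warping_crossings D (curve D m) \<subseteq> warping_crossings D (curve D m')"
proof
  fix x
  assume "x \<in> warping_crossings D (curve D m)"
  then obtain s t where x: "x \<in> crossings D" and st: "curve D s = curve D m" "s < t"
    "curve D t = x" "\<And>u. s < u \<Longrightarrow> u < t \<Longrightarrow> curve D u \<noteq> x" "\<not> over D t"
    unfolding warping_crossings_def by blast
  have q_le: "q \<le> u" if "p < u" "curve D u = x" for u
    using gap that x unfolding gap_def crossing_times_def by force
  have "m \<notin> crossing_times D"
    using gap m by (auto simp: gap_def)
  \<comment> \<open>The definition allows any time at the base point, so it has to be moved into the gap.\<close>
  then obtain k where k: "s = m + of_int k"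
    using curve_eq_noncrossing[OF st(1)] by blast
  define t' where "t' = t - of_int k"
  have t: "t = t' + of_int k"
    by (simp add: t'_def)
  have "m < t'" "curve D t' = x" "\<not> over D t'"
    using st k t curve_add_int over_add_int by auto
  moreover have "curve D u \<noteq> x" if "m' < u" "u < t'" for u
  proof
    assume "curve D u = x"
    then have "m < u"
      using q_le[of u] m m' that by linarith
    then show False
      using st(4)[of "u + of_int k"] \<open>curve D u = x\<close> that k t curve_add_int by auto
  qed
  moreover have "m' < t'"
    using q_le[of t'] calculation m m' by linarith
  ultimately show "x \<in> warping_crossings D (curve D m')"
    unfolding warping_crossings_def using x by blast
qed

lemma warping_degree_at_edge_eq:
  assumes "e \<in> edges D" "b \<in> e \<inter> base_points D" "b' \<in> e \<inter> base_points D"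
  shows "warping_degree_at D b = warping_degree_at D b'"
proof (cases "crossings D = {}")
  case True
  then show ?thesis
    by (simp add: warping_degree_at_def warping_crossings_def)
next
  case False
  then obtain s t where st: "e = curve D ` {s..t}" "gap D s t"
    using assms(1) edges_eq_gap_images by blast
  have interior: "\<exists>m. a = curve D m \<and> s < m \<and> m < t" if a: "a \<in> e \<inter> base_points D" for a
  proof -
    obtain m where m: "a = curve D m" "s \<le> m" "m \<le> t"
      using a st(1) by auto
    moreover have "m \<notin> crossing_times D"
      using a m curve_in_base_points_iff by blast
    ultimately show ?thesis
      using st(2) unfolding gap_def by (metis order.order_iff_strict)
  qed
  obtain m m' where "b = curve D m" "s < m" "m < t" "b' = curve D m'" "s < m'" "m' < t"
    using interior[OF assms(2)] interior[OF assms(3)] by blast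
  then have "warping_crossings D b = warping_crossings D b'"
    using warping_crossings_gap_subset[OF st(2)] by (simp add: subset_antisym)
  then show ?thesis
    by (simp add: warping_degree_at_def)
qed

lemma edge_degree_eq:
  assumes "e \<in> edges D" "b \<in> e \<inter> base_points D"
  shows "edge_degree D e = warping_degree_at D b"
  unfolding edge_degree_def
proof (rule the_equality)
  show "\<forall>b'\<in>e \<inter> base_points D. warping_degree_at D b' = warping_degree_at D b"
    using assms warping_degree_at_edge_eq by blast
  show "i = warping_degree_at D b" if "\<forall>b'\<in>e \<inter> base_points D. warping_degree_at D b' = i" for i
    using assms(2) that by simp
qed

text \<open>
  Both inclusions are needed to compare minima: edges carry base points, and the edges cover all
  base points.
\<close>

lemma edge_degree_image: "edge_degree D ` edges D = warping_degree_at D ` base_points D"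
proof
  show "edge_degree D ` edges D \<subseteq> warping_degree_at D ` base_points D"
    using edge_has_base_point edge_degree_eq by blast
  show "warping_degree_at D ` base_points D \<subseteq> edge_degree D ` edges D"
  proof
    fix i
    assume "i \<in> warping_degree_at D ` base_points D"
    then obtain b where b: "b \<in> base_points D" "i = warping_degree_at D b"
      by blast
    obtain e where e: "e \<in> edges D" "b \<in> e"
      using base_point_on_edge[OF b(1)] .
    then have "i = edge_degree D e"
      using b edge_degree_eq by simp
    then show "i \<in> edge_degree D ` edges D"
      using e(1) by (rule image_eqI)
  qed
qed

lemma edges_nonempty: "edges D \<noteq> {}"
proof (cases "crossings D = {}")
  case True
  then show ?thesis by (simp add: edges_def)
next
  case False
  then obtain s where "s \<in> crossing_times D"
    by (auto simp: crossings_def crossing_times_def)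
  then show ?thesis
    using gap_from_crossing_time edges_eq_gap_images[OF False] by blast
qed

end

section \<open>The warping polynomial\<close>

theorem proposition2p6:
  fixes D :: diagram
  assumes "knot_diagram D"
  shows "(crossing_number D = 0 \<longrightarrow> warping_polynomial D = 1) \<and>
         ldeg (warping_polynomial D) = warping_degree D \<and>
         (monotone_diagram D \<longleftrightarrow> poly (warping_polynomial D) 0 \<noteq> 0) \<and>
         (crossing_number D \<ge> 1 \<longrightarrow>
            poly (warping_polynomial D) 1 = 2 * int (crossing_number D))"
proof -
  interpret knot D
    by unfold_locales (rule assms)
  have deg_Min: "warping_degree D = Min (edge_degree D ` edges D)"
    by (simp add: warping_degree_def edge_degree_image)
  have "warping_polynomial D = 1" if "crossing_number D = 0"
  proof -
    have none: "crossings D = {}"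
      using that finite_crossings by (simp add: crossing_number_def)
    then have edges: "edges D = {range (curve D)}"
      by (simp add: edges_def)
    obtain b where "b \<in> range (curve D) \<inter> base_points D"
      using edge_has_base_point edges by blast
    then have "edge_degree D (range (curve D)) = warping_degree_at D b"
      using edge_degree_eq edges by blast
    also have "\<dots> = 0"
      using none by (simp add: warping_degree_at_def warping_crossings_def)
    finally show ?thesis
      by (simp add: warping_polynomial_def edges)
  qed
  moreover have "ldeg (warping_polynomial D) = warping_degree D"
    unfolding warping_polynomial_def deg_Min
    by (rule ldeg_sum_monom[OF finite_edges edges_nonempty])
  moreover have "monotone_diagram D \<longleftrightarrow> poly (warping_polynomial D) 0 \<noteq> 0"
  proof -
    have "Min (edge_degree D ` edges D) = 0 \<longleftrightarrow> 0 \<in> edge_degree D ` edges D"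
      using finite_edges edges_nonempty by (subst Min_eq_iff) auto
    then show ?thesis
      unfolding monotone_diagram_def deg_Min poly_0_coeff_0 warping_polynomial_def
      using coeff_sum_monom_neq_0_iff[OF finite_edges] by blast
  qed
  moreover have "poly (warping_polynomial D) 1 = 2 * int (crossing_number D)"
    if "crossing_number D \<ge> 1"
  proof -
    have "crossings D \<noteq> {}"
      using that by (auto simp: crossing_number_def)
    then show ?thesis
      using card_edges by (simp add: warping_polynomial_def poly_sum poly_monom)
  qed
  ultimately show ?thesis by blast
qed

end
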